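(* For every integer $n \geq 32$, the approximation $\pi \approx \Pi(n)$ is in excess, i.e. $\Pi(n) > \pi$.
   Context: For a positive integer $n \geq 3$, define the Chakrabarti--Hudson approximation to $\pi$ by $$\Pi(n) := \frac{n}{30}\left\{32\sin\Bigl(\frac{\pi}{n}\Bigr) + 4\tan\Bigl(\frac{\pi}{n}\Bigr) - 3\sin\Bigl(\frac{2\pi}{n}\Bigr)\right\}.$$ *)

theory Defs
  imports Complex_Main
begin

text \<open>The Chakrabarti--Hudson approximation to \<open>pi\<close>, intended for \<open>n \<ge> 3\<close>
  (the value at \<open>n = 0\<close> and, because of the pole of the tangent, at \<open>n = 2\<close>
  is an artefact of totality).\<close>

definition chakrabarti_hudson :: "nat \<Rightarrow> real" where
  "chakrabarti_hudson n =
     real n / 30 * (32 * sin (pi / real n) + 4 * tan (pi / real n) - 3 * sin (2 * pi / real n))"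

end

theory Submission
  imports Defs
begin

text \<open>With \<open>x = pi / n\<close> the claim reads \<open>30 x < 32 sin x + 4 tan x - 3 sin (2 x)\<close>. Both sides
  vanish at \<open>0\<close>, and with \<open>c = cos x\<close> the derivative of their difference is
  \<open>4 (1 - c)^3 (1 + 3 c) / c^2\<close>, which is positive on \<open>(0, pi / 2)\<close>.\<close>

lemma sin_tan_combination_gt:
  fixes x :: real
  assumes "0 < x" "x < pi / 2"
  shows "30 * x < 32 * sin x + 4 * tan x - 3 * sin (2 * x)"
proof -
  define f where "f t = 32 * sin t + 4 * tan t - 3 * sin (2 * t) - 30 * t" for t :: real
  define f' where "f' t = 4 * (1 - cos t) ^ 3 * (1 + 3 * cos t) / (cos t)\<^sup>2" for t :: real
  have deriv: "(f has_real_derivative f' t) (at t)" if "0 \<le> t" "t \<le> x" for t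
  proof -
    have c: "cos t > 0"
      using that assms by (intro cos_gt_zero_pi) auto
    have "(f has_real_derivative
        32 * cos t + 4 * inverse ((cos t)\<^sup>2) - 6 * cos (2 * t) - 30) (at t)"
      unfolding f_def using c by (auto intro!: derivative_eq_intros)
    \<comment> \<open>With \<open>c = cos t\<close> and \<open>cos (2 * t) = 2 * c^2 - 1\<close>,
      both sides times \<open>c^2\<close> equal
      \<open>4 - 24 * c^2 + 32 * c^3 - 12 * c^4\<close>.\<close>
    moreover have "32 * cos t + 4 * inverse ((cos t)\<^sup>2) - 6 * cos (2 * t) - 30 = f' t"
      unfolding f'_def cos_double_cos using c by (simp add: field_simps power2_eq_square power3_eq_cube)
    ultimately show ?thesis by simp
  qed
  have pos: "f' t > 0" if "0 < t" "t < x" for t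
  proof -
    have "cos t > 0"
      using that assms by (intro cos_gt_zero_pi) auto
    moreover have "cos t < 1"
      using cos_monotone_0_pi[of 0 t] that assms by simp
    ultimately show ?thesis by (simp add: f'_def)
  qed
  have "f 0 < f x"
  \<comment> \<open>Since \<open>f' 0 = 0\<close>, the derivative is not positive on all of the
    closed interval; the open version asks only for continuity at the endpoints.\<close>
  proof (rule DERIV_pos_imp_increasing_open[OF assms(1)])
    show "\<exists>y. (f has_real_derivative y) (at t) \<and> y > 0" if "0 < t" "t < x" for t
      using deriv[of t] pos[of t] that by auto
    show "continuous_on {0..x} f"
      using deriv by (auto intro!: DERIV_atLeastAtMost_imp_continuous_on)
  qed
  then show ?thesis by (simp add: f_def)
qed

theorem corollary1:
  fixes n :: nat
  assumes "n \<ge> 32"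
  shows "chakrabarti_hudson n > pi"
proof -
  \<comment> \<open>This puts \<open>pi / n\<close> strictly below \<open>pi / 2\<close>, before the
    pole of the tangent.\<close>
  have n: "real n > 2" using assms by simp
  then have "30 * (pi / n) < 32 * sin (pi / n) + 4 * tan (pi / n) - 3 * sin (2 * (pi / n))"
    by (intro sin_tan_combination_gt) (simp_all add: field_simps)
  then have "real n / 30 * (30 * (pi / n)) < chakrabarti_hudson n"
    unfolding chakrabarti_hudson_def using n by (intro mult_strict_left_mono) simp_all
  then show ?thesis using n by simp
qed

end
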